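(* Let $A,B\in M_{n,m}$, and let $A',B'\in M_{n,m}$ be obtained from $A,B$ via Reduction (I) or via Reduction (II) described in the context. Then $A\preceq^w B$ if and only if $A'\preceq^w B'$. In addition, $B'$ is column stochastic.
   Context: $M_{n,m}$ is the space of real $n\times m$ matrices; $J$ is the $n\times m$ all-ones matrix; $e$ is the all-ones column vector of the appropriate size. A matrix is row (resp. column) stochastic if it is nonnegative with every row (resp. column) sum equal to $1$. Weak majorization: $A\preceq^w B$ means $A=RB$ for some row stochastic $n\times n$ matrix $R$. Reduction (I): choose any $\lambda\ge0$ such that $A_1=A+\lambda J$ and $B_1=B+\lambda J$ are nonnegative; choose any $\mu>0$ such that the column sums of $A_2=\frac1\mu A_1$ and $B_2=\frac1\mu B_1$ do not exceed $1$; define $v\in\mathbb{R}^m$ by $v^t=\frac1n(e^t-e^tB_2)$; put $A'=A_2+ev^t$, $B'=B_2+ev^t$. Reduction (II): choose any $\lambda\ge 0$ such that $A_1=A+\lambda J$ and $B_1=B+\lambda J$ are nonnegative and have no zero columns; let $D=\mathrm{diag}(e^tB_1)$ be the $m\times m$ diagonal matrix of the column sums of $B_1$; put $A'=A_1D^{-1}$, $B'=B_1D^{-1}$. *)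

theory Defs
  imports "HOL-Analysis.Analysis"
begin

(* A real n x m matrix has type real^'m^'n, and M $ i $ j is the entry in row i, column j. *)

definition nonneg_matrix :: "real^'m^'n \<Rightarrow> bool" where
  "nonneg_matrix M \<longleftrightarrow> (\<forall>i j. 0 \<le> M $ i $ j)"

definition row_stochastic :: "real^'m^'n \<Rightarrow> bool" where
  "row_stochastic M \<longleftrightarrow> nonneg_matrix M \<and> (\<forall>i. (\<Sum>j\<in>UNIV. M $ i $ j) = 1)"

definition column_stochastic :: "real^'m^'n \<Rightarrow> bool" where
  "column_stochastic M \<longleftrightarrow> nonneg_matrix M \<and> (\<forall>j. (\<Sum>i\<in>UNIV. M $ i $ j) = 1)"

definition weakly_majorized :: "real^'m^'n \<Rightarrow> real^'m^'n \<Rightarrow> bool"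
    (infix "\<preceq>\<^sup>w" 50) where
  "A \<preceq>\<^sup>w B \<longleftrightarrow> (\<exists>R :: real^'n^'n. row_stochastic R \<and> A = R ** B)"

definition ones_vec :: "real^'n" where
  "ones_vec = (\<chi> i. 1)"

definition ones_mat :: "real^'m^'n" where
  "ones_mat = (\<chi> i j. 1)"

definition diag_mat :: "real^'m \<Rightarrow> real^'m^'m" where
  "diag_mat d = (\<chi> i j. if i = j then d $ i else 0)"

(* The rank-one matrix x y^t. *)
definition outer_prod :: "real^'n \<Rightarrow> real^'m \<Rightarrow> real^'m^'n" where
  "outer_prod x y = (\<chi> i j. x $ i * y $ j)"

(* The row vector e^t M of column sums is written ones_vec v* M.  In both reductions the
   parameters are existentially quantified: the relation holds iff (A', B') arises from (A, B)
   for some admissible choice of them. *)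

definition reduction_I ::
    "real^'m^'n \<Rightarrow> real^'m^'n \<Rightarrow> real^'m^'n \<Rightarrow> real^'m^'n \<Rightarrow> bool" where
  "reduction_I A B A' B' \<longleftrightarrow>
     (\<exists>l \<mu> A1 B1 A2 B2 v.
        0 \<le> l \<and> A1 = A + l *\<^sub>R ones_mat \<and> B1 = B + l *\<^sub>R ones_mat \<and>
        nonneg_matrix A1 \<and> nonneg_matrix B1 \<and>
        0 < \<mu> \<and> A2 = (1 / \<mu>) *\<^sub>R A1 \<and> B2 = (1 / \<mu>) *\<^sub>R B1 \<and>
        (\<forall>j. (ones_vec v* A2) $ j \<le> 1) \<and> (\<forall>j. (ones_vec v* B2) $ j \<le> 1) \<and>
        v = (1 / real CARD('n)) *\<^sub>R (ones_vec - ones_vec v* B2) \<and>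
        A' = A2 + outer_prod ones_vec v \<and> B' = B2 + outer_prod ones_vec v)"

definition reduction_II ::
    "real^'m^'n \<Rightarrow> real^'m^'n \<Rightarrow> real^'m^'n \<Rightarrow> real^'m^'n \<Rightarrow> bool" where
  "reduction_II A B A' B' \<longleftrightarrow>
     (\<exists>l A1 B1 D.
        0 \<le> l \<and> A1 = A + l *\<^sub>R ones_mat \<and> B1 = B + l *\<^sub>R ones_mat \<and>
        nonneg_matrix A1 \<and> nonneg_matrix B1 \<and>
        (\<forall>j. column j A1 \<noteq> 0) \<and> (\<forall>j. column j B1 \<noteq> 0) \<and>
        D = diag_mat (ones_vec v* B1) \<and>
        A' = A1 ** matrix_inv D \<and> B' = B1 ** matrix_inv D)"

end

theory Submission
  imports Defs
begin

text \<open>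
  Weak majorization is a statement about left multiplication by a row stochastic matrix \<open>R\<close>,
  so it is preserved and reflected by every injective operation on matrices that commutes with
  all such multiplications. Three operations of this kind suffice. Scaling by a nonzero number
  (\<open>weakly_majorized_scaleR\<close>) and right multiplication by an invertible matrix
  (\<open>weakly_majorized_mult_right\<close>) commute with left multiplication by any matrix. Adding
  \<open>e w\<^sup>t\<close>, a matrix with equal rows, commutes because \<open>R e = e\<close>
  (\<open>weakly_majorized_add_outer_ones\<close>); this includes adding \<open>\<lambda>J = e (\<lambda>e)\<^sup>t\<close>. Each
  reduction is a composition of these operations, applied to both matrices alike. In the second
  one \<open>D\<close> is invertible, since a nonzero nonnegative column has a positive sum.

  The parameters are tuned to make \<open>B'\<close> column stochastic: the first reduction spreads the
  deficit \<open>1 - s\<^sub>j \<ge> 0\<close> of the \<open>j\<close>-th column sum \<open>s\<^sub>j\<close> of \<open>B\<^sub>2\<close> evenly over the \<open>n\<close> entries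
  of that column, the second divides each column of \<open>B\<^sub>1\<close> by its sum.
\<close>

text \<open>
  Each row of \<open>R (e w\<^sup>t)\<close> is an average, with weights from a row of \<open>R\<close>, of copies of the
  same vector \<open>w\<^sup>t\<close>.
\<close>

lemma row_stochastic_mult_outer_ones:
  fixes R :: "real^'n^'n"
  assumes "row_stochastic R"
  shows "R ** outer_prod ones_vec w = outer_prod ones_vec w"
  using assms
  by (simp add: row_stochastic_def vec_eq_iff matrix_matrix_mult_def outer_prod_def
      ones_vec_def flip: sum_distrib_right)

lemma weakly_majorized_add_outer_ones:
  "(A + outer_prod ones_vec w) \<preceq>\<^sup>w (B + outer_prod ones_vec w) \<longleftrightarrow> A \<preceq>\<^sup>w B"
proof -
  have "A + outer_prod ones_vec w = R ** (B + outer_prod ones_vec w) \<longleftrightarrow> A = R ** B"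
    if "row_stochastic R" for R
    using row_stochastic_mult_outer_ones[OF that, of w] by (simp add: matrix_add_ldistrib)
  then show ?thesis
    unfolding weakly_majorized_def by blast
qed

lemma weakly_majorized_mult_right:
  fixes A B :: "real^'m^'n" and P Q :: "real^'m^'m"
  assumes "P ** Q = mat 1"
  shows "(A ** P) \<preceq>\<^sup>w (B ** P) \<longleftrightarrow> A \<preceq>\<^sup>w B"
proof -
  have cancel: "X ** P ** Q = X" for X :: "real^'m^'n"
    using assms by (simp flip: matrix_mul_assoc)
  have "A ** P = R ** (B ** P) \<longleftrightarrow> A = R ** B" for R :: "real^'n^'n"
    using cancel by (metis matrix_mul_assoc)
  then show ?thesis
    unfolding weakly_majorized_def by blast
qed

lemma weakly_majorized_scaleR:
  fixes A B :: "real^'m^'n"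
  assumes "c \<noteq> 0"
  shows "(c *\<^sub>R A) \<preceq>\<^sup>w (c *\<^sub>R B) \<longleftrightarrow> A \<preceq>\<^sup>w B"
proof -
  have "c *\<^sub>R A = R ** (c *\<^sub>R B) \<longleftrightarrow> A = R ** B" for R :: "real^'n^'n"
    using assms by (simp add: matrix_scalar_ac flip: scalar_matrix_assoc)
  then show ?thesis
    unfolding weakly_majorized_def by blast
qed

lemma weakly_majorized_add_ones_mat:
  fixes A B :: "real^'m^'n"
  shows "(A + l *\<^sub>R ones_mat) \<preceq>\<^sup>w (B + l *\<^sub>R ones_mat) \<longleftrightarrow> A \<preceq>\<^sup>w B"
proof -
  have "(l *\<^sub>R ones_mat :: real^'m^'n) = outer_prod ones_vec (l *\<^sub>R ones_vec)"
    by (simp add: vec_eq_iff ones_mat_def outer_prod_def ones_vec_def)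
  then show ?thesis
    by (simp only: weakly_majorized_add_outer_ones)
qed

lemma ones_vec_mult_component: "(ones_vec v* M) $ j = (\<Sum>i\<in>UNIV. M $ i $ j)"
  by (simp add: vector_matrix_mult_def ones_vec_def)

lemma mult_diag_mat_component: "(M ** diag_mat d) $ i $ j = M $ i $ j * d $ j"
  by (simp add: matrix_matrix_mult_def diag_mat_def if_distrib cong: if_cong)

lemma diag_mat_mult_inverse:
  assumes "\<And>j. d $ j \<noteq> 0"
  shows "diag_mat d ** diag_mat (\<chi> j. inverse (d $ j)) = mat 1"
    and "diag_mat (\<chi> j. inverse (d $ j)) ** diag_mat d = mat 1"
  using assms
  by (simp_all add: vec_eq_iff mult_diag_mat_component) (simp_all add: diag_mat_def mat_def)

lemma matrix_inv_eqI:
  fixes M N :: "real^'m^'m"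
  assumes "M ** N = mat 1" and "N ** M = mat 1"
  shows "matrix_inv M = N"
proof -
  have "M ** matrix_inv M = mat 1"
    using assms unfolding matrix_inv_def by (metis (mono_tags, lifting) someI_ex)
  then show ?thesis
    using assms(2) by (metis matrix_mul_assoc matrix_mul_lid matrix_mul_rid)
qed

lemma matrix_inv_diag_mat:
  assumes "\<And>j. d $ j \<noteq> 0"
  shows "matrix_inv (diag_mat d) = diag_mat (\<chi> j. inverse (d $ j))"
  using diag_mat_mult_inverse[OF assms] by (rule matrix_inv_eqI)

lemma column_sum_pos:
  assumes "nonneg_matrix M" and "column j M \<noteq> 0"
  shows "0 < (ones_vec v* M) $ j"
proof -
  obtain i where "M $ i $ j \<noteq> 0"
    using assms(2) by (auto simp: column_def vec_eq_iff)
  with assms(1) have "0 < M $ i $ j"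
    by (simp add: nonneg_matrix_def order_less_le)
  with assms(1) show ?thesis
    unfolding ones_vec_mult_component nonneg_matrix_def by (intro sum_pos2[of UNIV i]) auto
qed

text \<open>
  The \<open>n\<close> entries of column \<open>j\<close> all grow by \<open>(1 - s\<^sub>j) / n\<close>, where \<open>s\<^sub>j\<close> is the column sum; the bound
  \<open>s\<^sub>j \<le> 1\<close> keeps the increment nonnegative.
\<close>

lemma column_stochastic_fill_deficit:
  fixes M :: "real^'m^'n"
  assumes "nonneg_matrix M" and "\<And>j. (ones_vec v* M) $ j \<le> 1"
  shows "column_stochastic
    (M + outer_prod ones_vec ((1 / real CARD('n)) *\<^sub>R (ones_vec - ones_vec v* M)))"
  using assms
  by (simp add: column_stochastic_def nonneg_matrix_def outer_prod_def ones_vec_mult_component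
      sum.distrib) (simp add: ones_vec_def)

lemma column_stochastic_normalize_columns:
  assumes "nonneg_matrix M" and "\<And>j. 0 < (ones_vec v* M) $ j"
  shows "column_stochastic (M ** matrix_inv (diag_mat (ones_vec v* M)))"
proof -
  have nz: "(ones_vec v* M) $ j \<noteq> 0" for j
    using assms(2)[of j] by simp
  have entry: "(M ** matrix_inv (diag_mat (ones_vec v* M))) $ i $ j
      = M $ i $ j * inverse ((ones_vec v* M) $ j)" for i j
    by (simp add: matrix_inv_diag_mat[OF nz] mult_diag_mat_component)
  have "(\<Sum>i\<in>UNIV. M $ i $ j * inverse ((ones_vec v* M) $ j)) = 1" for j
    using nz[of j] by (simp add: ones_vec_mult_component flip: sum_distrib_right)
  then show ?thesis
    using assms by (simp add: column_stochastic_def nonneg_matrix_def entry less_imp_le)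
qed

lemma reduction_I_correct:
  fixes A B A' B' :: "real^'m^'n"
  assumes "reduction_I A B A' B'"
  shows "(A \<preceq>\<^sup>w B \<longleftrightarrow> A' \<preceq>\<^sup>w B') \<and> column_stochastic B'"
proof -
  obtain l \<mu> A2 B2 v where
    "nonneg_matrix (B + l *\<^sub>R ones_mat)" and "0 < \<mu>"
    and A2: "A2 = (1 / \<mu>) *\<^sub>R (A + l *\<^sub>R ones_mat)"
    and B2: "B2 = (1 / \<mu>) *\<^sub>R (B + l *\<^sub>R ones_mat)"
    and sums: "\<And>j. (ones_vec v* B2) $ j \<le> 1"
    and v: "v = (1 / real CARD('n)) *\<^sub>R (ones_vec - ones_vec v* B2)"
    and A': "A' = A2 + outer_prod ones_vec v" and B': "B' = B2 + outer_prod ones_vec v"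
    using assms unfolding reduction_I_def by metis
  then have scale: "1 / \<mu> \<noteq> 0" and "nonneg_matrix B2"
    by (simp_all add: nonneg_matrix_def)
  from this(2) have "column_stochastic B'"
    using sums unfolding B' v by (rule column_stochastic_fill_deficit)
  moreover have "A' \<preceq>\<^sup>w B' \<longleftrightarrow> A \<preceq>\<^sup>w B"
    unfolding A' B' A2 B2
    by (simp only: weakly_majorized_add_outer_ones weakly_majorized_add_ones_mat
        weakly_majorized_scaleR[OF scale])
  ultimately show ?thesis by simp
qed

lemma reduction_II_correct:
  assumes "reduction_II A B A' B'"
  shows "(A \<preceq>\<^sup>w B \<longleftrightarrow> A' \<preceq>\<^sup>w B') \<and> column_stochastic B'"
proof -
  obtain l B1 D where B1: "B1 = B + l *\<^sub>R ones_mat"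
    and nonneg: "nonneg_matrix B1" and "\<And>j. column j B1 \<noteq> 0"
    and D: "D = diag_mat (ones_vec v* B1)"
    and A': "A' = (A + l *\<^sub>R ones_mat) ** matrix_inv D" and B': "B' = B1 ** matrix_inv D"
    using assms unfolding reduction_II_def by metis
  then have pos: "0 < (ones_vec v* B1) $ j" for j
    by (intro column_sum_pos)
  then have nz: "(ones_vec v* B1) $ j \<noteq> 0" for j
    by (metis less_irrefl)
  have "matrix_inv D ** D = mat 1"
    unfolding D matrix_inv_diag_mat[OF nz] by (rule diag_mat_mult_inverse(2)[OF nz])
  then have "A' \<preceq>\<^sup>w B' \<longleftrightarrow> (A + l *\<^sub>R ones_mat) \<preceq>\<^sup>w B1"
    unfolding A' B' by (rule weakly_majorized_mult_right)
  also have "\<dots> \<longleftrightarrow> A \<preceq>\<^sup>w B"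
    unfolding B1 by (rule weakly_majorized_add_ones_mat)
  finally show ?thesis
    using column_stochastic_normalize_columns[OF nonneg pos] by (simp add: B' D)
qed

theorem corollary3p9:
  fixes A B A' B' :: "real^'m^'n"
  assumes "reduction_I A B A' B' \<or> reduction_II A B A' B'"
  shows "(A \<preceq>\<^sup>w B \<longleftrightarrow> A' \<preceq>\<^sup>w B') \<and> column_stochastic B'"
  using assms reduction_I_correct reduction_II_correct by blast

end
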